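(* Let $u$ and $v$ be two functions in $L^p(X)$, for $1<p\le\infty$, or in $C(X)$, for $p=1$. If $u\le v$ a.e. on $X$, then $\mu_p^X(u)\le\mu_p^X(v)$.
   Context: $X$ is a compact topological space which is also a measure space with respect to a positive (nonzero) Radon measure $\nu$ with $\nu(X)<\infty$; $L^p(X)=L^p(X,\nu)$ (real-valued functions), and "a.e." refers to $\nu$. For $1<p\le\infty$ and $u\in L^p(X)$, and for $p=1$ and $u\in C(X)$, $\mu_p^X(u)$ denotes the unique real number such that $\|u-\mu_p^X(u)\|_{L^p(X)}=\min_{\lambda\in\mathbb{R}}\|u-\lambda\|_{L^p(X)}$. For $p=1$, it is part of the setting that $(X,\nu)$ is such that this minimizer is unique for every $u\in C(X)$. *)

theory Defs
  imports "HOL-Probability.Probability"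
begin

text \<open>
  A Radon measure on \<open>X\<close> is a Borel measure that is finite on compact sets, outer regular on
  Borel sets and inner regular on open sets.  \<open>X\<close> need not be Hausdorff, so compact sets need
  not be Borel; only Borel compact sets are used, since \<^const>\<open>emeasure\<close> is \<open>0\<close> off \<open>sets \<nu>\<close>.
\<close>

definition radon_measure :: "'a topology \<Rightarrow> 'a measure \<Rightarrow> bool" where
  "radon_measure X \<nu> \<longleftrightarrow>
     sets \<nu> = sets (sigma (topspace X) {U. openin X U}) \<and>
     (\<forall>K\<in>sets \<nu>. compactin X K \<longrightarrow> emeasure \<nu> K < \<infinity>) \<and>
     (\<forall>A\<in>sets \<nu>. emeasure \<nu> A = (INF U\<in>{U. openin X U \<and> A \<subseteq> U}. emeasure \<nu> U)) \<and>
     (\<forall>U. openin X U \<longrightarrow>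
        emeasure \<nu> U = (SUP K\<in>{K\<in>sets \<nu>. compactin X K \<and> K \<subseteq> U}. emeasure \<nu> K))"

text \<open>
  Elements of \<open>L\<^sup>p(\<nu>)\<close>, \<open>1 \<le> p \<le> \<infinity>\<close>, are represented by functions rather than by
  classes of functions that agree almost everywhere; \<open>Lp_norm\<close> is meant to be applied only
  to functions in \<open>Lp_space\<close>.
\<close>

definition Lp_space :: "'a measure \<Rightarrow> ennreal \<Rightarrow> ('a \<Rightarrow> real) set" where
  "Lp_space \<nu> p = {u \<in> borel_measurable \<nu>.
     if p = \<infinity> then esssup \<nu> (\<lambda>x. ennreal \<bar>u x\<bar>) < \<infinity>
     else integrable \<nu> (\<lambda>x. \<bar>u x\<bar> powr enn2real p)}"

definition Lp_norm :: "'a measure \<Rightarrow> ennreal \<Rightarrow> ('a \<Rightarrow> real) \<Rightarrow> real" where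
  "Lp_norm \<nu> p u =
     (if p = \<infinity> then enn2real (esssup \<nu> (\<lambda>x. ennreal \<bar>u x\<bar>))
      else (\<integral>x. \<bar>u x\<bar> powr enn2real p \<partial>\<nu>) powr (1 / enn2real p))"

definition is_p_mean :: "'a measure \<Rightarrow> ennreal \<Rightarrow> ('a \<Rightarrow> real) \<Rightarrow> real \<Rightarrow> bool" where
  "is_p_mean \<nu> p u m \<longleftrightarrow>
     (\<forall>c::real. Lp_norm \<nu> p (\<lambda>x. u x - m) \<le> Lp_norm \<nu> p (\<lambda>x. u x - c))"

text \<open>
  The minimizer exists and is unique for \<open>1 < p\<close> and functions in \<open>Lp_space\<close> when \<open>\<nu>\<close> is finite
  and nonzero; for \<open>p = 1\<close> uniqueness can fail, and then \<open>p_mean\<close> is unspecified.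
\<close>

definition p_mean :: "'a measure \<Rightarrow> ennreal \<Rightarrow> ('a \<Rightarrow> real) \<Rightarrow> real" where
  "p_mean \<nu> p u = (THE m. is_p_mean \<nu> p u m)"

end

theory Submission
  imports Defs
begin

text \<open>
  For \<open>p < \<infinity>\<close> put \<open>F\<^sub>u c = \<integral>\<bar>u - c\<bar>\<^sup>p\<close>.  Convexity of \<open>\<bar>x\<bar>\<^sup>p\<close> makes the pairing
  submodular: \<open>u \<le> v\<close> and \<open>b \<le> a\<close> imply \<open>F\<^sub>u b + F\<^sub>v a \<le> F\<^sub>u a + F\<^sub>v b\<close>.  If \<open>a\<close>
  minimizes \<open>F\<^sub>u\<close> and \<open>b\<close> minimizes \<open>F\<^sub>v\<close>, then \<open>b\<close> minimizes \<open>F\<^sub>u\<close> as well or \<open>a\<close>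
  minimizes \<open>F\<^sub>v\<close> as well, so \<open>b < a\<close> contradicts uniqueness.  For \<open>p = \<infinity>\<close> the sum is
  replaced by the maximum.
\<close>

section \<open>Tangent lines, convexity and submodularity of \<open>|x| powr q\<close>\<close>

text \<open>For \<open>x > 0\<close> the mean value theorem applies, and the derivative
  \<open>q * z powr (q - 1)\<close> is strictly increasing. For \<open>x <= 0\<close> the tangent
  line has already dropped to at most \<open>(1 - q) * m powr q\<close>, which is negative.\<close>

lemma powr_tangent_strict_pos:
  fixes q x m :: real
  assumes q: "q > 1" and m: "m > 0" and "x \<noteq> m"
  shows "m powr q + q * m powr (q - 1) * (x - m) < \<bar>x\<bar> powr q"
proof (cases "x \<le> 0")
  case True
  have mq: "m powr (q - 1) * m = m powr q"
    using m powr_add[of m "q - 1" 1] by simp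
  have "q * m powr (q - 1) * (x - m) \<le> q * m powr (q - 1) * (- m)"
    using True q by (intro mult_left_mono) auto
  also have "\<dots> = - q * m powr q"
    by (simp add: mq mult.assoc)
  finally have "m powr q + q * m powr (q - 1) * (x - m) \<le> (1 - q) * m powr q"
    by (simp add: algebra_simps)
  also have "\<dots> < 0"
    using q m by (simp add: mult_neg_pos)
  finally show ?thesis
    using powr_ge_zero[of "\<bar>x\<bar>" q] by linarith
next
  case False
  have deriv: "((\<lambda>z. z powr q) has_real_derivative q * z powr (q - 1)) (at z)" if "z > 0" for z
    using that by (auto intro!: derivative_eq_intros)
  show ?thesis
  proof (cases "x < m")
    case True
    then obtain z where z: "x < z" "z < m" "m powr q - x powr q = (m - x) * (q * z powr (q - 1))"
      using MVT2[of x m "\<lambda>z. z powr q" "\<lambda>z. q * z powr (q - 1)"] deriv False by auto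
    have "z powr (q - 1) < m powr (q - 1)"
      using z False q by (intro powr_less_mono2) auto
    then have "(m - x) * (q * z powr (q - 1)) < (m - x) * (q * m powr (q - 1))"
      using q True by (intro mult_strict_left_mono) auto
    then show ?thesis
      using z False by (simp add: algebra_simps)
  next
    case False
    then have "m < x" using assms by simp
    then obtain z where z: "m < z" "z < x" "x powr q - m powr q = (x - m) * (q * z powr (q - 1))"
      using MVT2[of m x "\<lambda>z. z powr q" "\<lambda>z. q * z powr (q - 1)"] deriv m by auto
    have "m powr (q - 1) < z powr (q - 1)"
      using z m q by (intro powr_less_mono2) auto
    then have "(x - m) * (q * m powr (q - 1)) < (x - m) * (q * z powr (q - 1))"
      using q \<open>m < x\<close> by (intro mult_strict_left_mono) auto
    then show ?thesis
      using z m \<open>m < x\<close> by (simp add: algebra_simps)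
  qed
qed

text \<open>Reflecting both \<open>x\<close> and \<open>m\<close> at the origin reduces
  \<open>m < 0\<close> to the positive case; at \<open>m = 0\<close> the whole left side
  vanishes.\<close>

lemma abs_powr_tangent_strict:
  fixes q x m :: real
  assumes q: "q > 1" and xm: "x \<noteq> m"
  shows "\<bar>m\<bar> powr q + q * sgn m * \<bar>m\<bar> powr (q - 1) * (x - m) < \<bar>x\<bar> powr q"
proof (cases m "0 :: real" rule: linorder_cases)
  case less
  then show ?thesis
    using powr_tangent_strict_pos[of q "- m" "- x"] q xm by (simp add: algebra_simps)
next
  case equal
  then show ?thesis using xm by simp
next
  case greater
  then show ?thesis
    using powr_tangent_strict_pos[of q m x] q xm by simp
qed

text \<open>A supporting line at every point forces convexity. The exponent \<open>1\<close> is
  treated apart because the strict tangent bound requires \<open>q > 1\<close>.\<close>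

lemma convex_on_abs_powr:
  fixes q :: real
  assumes "q \<ge> 1"
  shows "convex_on UNIV (\<lambda>x::real. \<bar>x\<bar> powr q)"
proof (cases "q = 1")
  case True
  then show ?thesis
    using convex_on_dist[of "UNIV :: real set" 0] by (simp add: dist_real_def)
next
  case False
  with assms have q: "q > 1" by simp
  show ?thesis
  proof (rule convex_onI)
    fix t x y :: real
    assume t: "t > 0" "t < 1"
    define m where "m = (1 - t) *\<^sub>R x + t *\<^sub>R y"
    define D where "D = q * sgn m * \<bar>m\<bar> powr (q - 1)"
    have tangent: "\<bar>m\<bar> powr q + D * (z - m) \<le> \<bar>z\<bar> powr q" for z
      using abs_powr_tangent_strict[OF q, of z m] unfolding D_def by (cases "z = m") auto
    \<comment> \<open>Since \<open>m\<close> is the weighted mean of \<open>x\<close> and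
      \<open>y\<close>, the slope terms cancel when the two tangent bounds are averaged.\<close>
    have "(1 - t) * (\<bar>m\<bar> powr q + D * (x - m)) + t * (\<bar>m\<bar> powr q + D * (y - m))
        \<le> (1 - t) * \<bar>x\<bar> powr q + t * \<bar>y\<bar> powr q"
      using t tangent by (intro add_mono mult_left_mono) auto
    moreover have "(1 - t) * (\<bar>m\<bar> powr q + D * (x - m)) + t * (\<bar>m\<bar> powr q + D * (y - m))
        = \<bar>m\<bar> powr q"
      by (simp add: m_def algebra_simps)
    ultimately show "\<bar>(1 - t) *\<^sub>R x + t *\<^sub>R y\<bar> powr q \<le> (1 - t) * \<bar>x\<bar> powr q + t * \<bar>y\<bar> powr q"
      by (simp add: m_def)
  qed simp
qed

text \<open>Neither endpoint equals the midpoint, so both tangent bounds at the midpoint are strict.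
  This is the strict convexity that later excludes two minimizers.\<close>

lemma abs_powr_midpoint_strict:
  fixes q x y :: real
  assumes "q > 1" and "x \<noteq> y"
  shows "\<bar>(x + y) / 2\<bar> powr q < (\<bar>x\<bar> powr q + \<bar>y\<bar> powr q) / 2"
proof -
  define m where "m = (x + y) / 2"
  define D where "D = q * sgn m * \<bar>m\<bar> powr (q - 1)"
  have ne: "x \<noteq> m" "y \<noteq> m" using assms(2) by (auto simp: m_def field_simps)
  have "D * (x - m) + D * (y - m) = 0"
    by (simp add: m_def field_simps)
  with abs_powr_tangent_strict[OF assms(1) ne(1)] abs_powr_tangent_strict[OF assms(1) ne(2)]
  show ?thesis
    unfolding D_def m_def[symmetric] by argo
qed

text \<open>The points \<open>s - b\<close> and \<open>t - a\<close> lie between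
  \<open>s - a\<close> and \<open>t - b\<close> and have the same sum, so they are convex
  combinations of these endpoints with swapped weights.\<close>

lemma convex_on_submodular:
  fixes f :: "real \<Rightarrow> real"
  assumes f: "convex_on UNIV f" and "s \<le> t" and "b \<le> a"
  shows "f (s - b) + f (t - a) \<le> f (s - a) + f (t - b)"
proof (cases "s = t \<and> b = a")
  case False
  define x y where "x = s - a" and "y = t - b"
  \<comment> \<open>Here \<open>y - x = (t - s) + (a - b)\<close>, which is zero only in the trivial
    case split off above.\<close>
  define l where "l = (a - b) / (y - x)"
  have xy: "x < y" using False assms by (auto simp: x_def y_def)
  have l: "0 \<le> l" "l \<le> 1" using xy assms by (auto simp: l_def x_def y_def divide_simps)
  have lh: "l * (y - x) = a - b" using xy by (simp add: l_def)
  have "(1 - l) *\<^sub>R x + l *\<^sub>R y = s - b" "(1 - l) *\<^sub>R y + l *\<^sub>R x = t - a"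
    using lh by (auto simp: x_def y_def algebra_simps)
  with convex_onD[OF f l, of x y] convex_onD[OF f l, of y x]
  have "f (s - b) + f (t - a) \<le> ((1 - l) * f x + l * f y) + ((1 - l) * f y + l * f x)"
    by simp
  also have "\<dots> = f x + f y" by (simp add: algebra_simps)
  finally show ?thesis by (simp add: x_def y_def)
qed simp

section \<open>Attained minima and the exchange argument\<close>

text \<open>Convexity gives continuity, hence a minimum on a compact interval; coercivity makes that
  minimum global. It serves finite exponents and the exponent infinity alike.\<close>

lemma convex_coercive_attains_min:
  fixes F :: "real \<Rightarrow> real"
  assumes F: "convex_on UNIV F" and k: "k > 0" and coercive: "\<And>c. k * \<bar>c\<bar> - K \<le> F c"
  shows "\<exists>m. \<forall>c. F m \<le> F c"
proof -
  \<comment> \<open>Chosen so that \<open>|c| >= R\<close> gives \<open>k * |c| - K >= F 0\<close>;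
    values outside the interval then cannot beat \<open>F 0\<close>.\<close>
  define R where "R = \<bar>F 0 + K\<bar> / k"
  have R: "R \<ge> 0" using k by (simp add: R_def)
  have "continuous_on UNIV F"
    by (rule convex_on_continuous) (use F in auto)
  then have "continuous_on {-R..R} F"
    by (rule continuous_on_subset) simp
  then obtain m where m: "\<And>c. c \<in> {-R..R} \<Longrightarrow> F m \<le> F c"
    using continuous_attains_inf[of "{-R..R}" F] R by fastforce
  have "F m \<le> F c" for c
  proof (cases "c \<in> {-R..R}")
    case False
    then have "R \<le> \<bar>c\<bar>" by auto
    then have "\<bar>F 0 + K\<bar> \<le> k * \<bar>c\<bar>" using k by (simp add: R_def field_simps)
    then have "F 0 \<le> F c" using coercive[of c] by linarith
    then show ?thesis using m[of 0] R by simp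
  qed (rule m)
  then show ?thesis by blast
qed

text \<open>Isolates the exchange argument from the exponent: only \<open>exch\<close> has to be
  proved separately for finite and infinite \<open>p\<close>.\<close>

lemma p_mean_mono_if:
  assumes u: "\<exists>!m. is_p_mean \<nu> p u m" and v: "\<exists>!m. is_p_mean \<nu> p v m"
    and exch: "\<And>a b. b < a \<Longrightarrow>
      Lp_norm \<nu> p (\<lambda>x. u x - b) \<le> Lp_norm \<nu> p (\<lambda>x. u x - a) \<or>
      Lp_norm \<nu> p (\<lambda>x. v x - a) \<le> Lp_norm \<nu> p (\<lambda>x. v x - b)"
  shows "p_mean \<nu> p u \<le> p_mean \<nu> p v"
proof (rule ccontr)
  define a b where "a = p_mean \<nu> p u" and "b = p_mean \<nu> p v"
  assume "\<not> p_mean \<nu> p u \<le> p_mean \<nu> p v"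
  then have "b < a" by (simp add: a_def b_def)
  have a: "is_p_mean \<nu> p u a" and b: "is_p_mean \<nu> p v b"
    unfolding a_def b_def p_mean_def by (rule theI'[OF u], rule theI'[OF v])
  \<comment> \<open>A competitor that is no worse than a minimizer is itself a minimizer; uniqueness
    then forces \<open>a = b\<close>.\<close>
  have "is_p_mean \<nu> p u b \<or> is_p_mean \<nu> p v a"
    using exch[OF \<open>b < a\<close>] a b unfolding is_p_mean_def by (meson order_trans)
  with a b u v \<open>b < a\<close> show False by blast
qed

subsection \<open>Finite exponents\<close>

text \<open>The root is strictly increasing on nonnegative reals, and both integrals are nonnegative
  even where the Bochner integral takes its default value \<open>0\<close>.\<close>

lemma Lp_norm_le_iff:
  assumes "1 \<le> p" "p \<noteq> \<infinity>"
  shows "Lp_norm \<nu> p f \<le> Lp_norm \<nu> p g \<longleftrightarrow>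
    (\<integral>x. \<bar>f x\<bar> powr enn2real p \<partial>\<nu>) \<le> (\<integral>x. \<bar>g x\<bar> powr enn2real p \<partial>\<nu>)"
proof -
  have "enn2real 1 \<le> enn2real p"
    using assms by (intro enn2real_mono) (auto simp: less_top)
  then have "0 < 1 / enn2real p" by simp
  moreover have "0 \<le> (\<integral>x. \<bar>f x\<bar> powr enn2real p \<partial>\<nu>)" "0 \<le> (\<integral>x. \<bar>g x\<bar> powr enn2real p \<partial>\<nu>)"
    by (auto intro: integral_nonneg_AE)
  ultimately show ?thesis
    using assms powr_less_mono2 powr_mono2 unfolding Lp_norm_def
    by (smt (verit, best))
qed

context finite_measure
begin

lemma integrable_abs_diff_powr:
  fixes u :: "'a \<Rightarrow> real" and q :: real
  assumes q: "q \<ge> 1" and [measurable]: "u \<in> borel_measurable M"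
    and u: "integrable M (\<lambda>x. \<bar>u x\<bar> powr q)"
  shows "integrable M (\<lambda>x. \<bar>u x - c\<bar> powr q)"
proof (rule Bochner_Integration.integrable_bound)
  show "integrable M (\<lambda>x. 2 powr q * (\<bar>u x\<bar> powr q + \<bar>c\<bar> powr q))"
    using u by simp
  \<comment> \<open>The factor \<open>2 powr q\<close> comes from
    \<open>|u x - c| <= 2 * max |u x| |c|\<close>. The constant summand of the bound is integrable
    because the measure is finite.\<close>
  have "\<bar>u x - c\<bar> powr q \<le> 2 powr q * (\<bar>u x\<bar> powr q + \<bar>c\<bar> powr q)" for x
  proof -
    have "\<bar>u x - c\<bar> powr q \<le> (2 * max \<bar>u x\<bar> \<bar>c\<bar>) powr q"
      using q by (intro powr_mono2) auto
    also have "\<dots> = 2 powr q * (max \<bar>u x\<bar> \<bar>c\<bar>) powr q"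
      by (simp add: powr_mult)
    also have "\<dots> \<le> 2 powr q * (\<bar>u x\<bar> powr q + \<bar>c\<bar> powr q)"
      by (intro mult_left_mono) (auto simp: max_def)
    finally show ?thesis .
  qed
  then show "AE x in M. norm (\<bar>u x - c\<bar> powr q) \<le> norm (2 powr q * (\<bar>u x\<bar> powr q + \<bar>c\<bar> powr q))"
    by (auto intro!: AE_I2 order_trans[OF _ abs_ge_self])
qed measurable

lemma exists_min_integral_abs_diff_powr:
  fixes u :: "'a \<Rightarrow> real" and q :: real
  assumes q: "q \<ge> 1" and [measurable]: "u \<in> borel_measurable M"
    and u: "integrable M (\<lambda>x. \<bar>u x\<bar> powr q)" and nz: "emeasure M (space M) \<noteq> 0"
  shows "\<exists>m. \<forall>c. (\<integral>x. \<bar>u x - m\<bar> powr q \<partial>M) \<le> (\<integral>x. \<bar>u x - c\<bar> powr q \<partial>M)"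
proof (rule convex_coercive_attains_min)
  note int[simp] = integrable_abs_diff_powr[OF q assms(2) u]
  \<comment> \<open>The total mass is the coercivity constant \<open>k\<close>; it is positive by
    \<open>nz\<close>.\<close>
  define V where "V = measure M (space M)"
  show "V > 0"
    using nz by (simp add: V_def emeasure_eq_measure zero_less_measure_iff)
  show "convex_on UNIV (\<lambda>c. \<integral>x. \<bar>u x - c\<bar> powr q \<partial>M)"
  proof (rule convex_onI)
    fix t a b :: real
    assume t: "t > 0" "t < 1"
    have "\<bar>u x - ((1 - t) *\<^sub>R a + t *\<^sub>R b)\<bar> powr q
        \<le> (1 - t) * \<bar>u x - a\<bar> powr q + t * \<bar>u x - b\<bar> powr q" for x
    proof -
      have "u x - ((1 - t) *\<^sub>R a + t *\<^sub>R b) = (1 - t) *\<^sub>R (u x - a) + t *\<^sub>R (u x - b)"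
        by (simp add: algebra_simps)
      then show ?thesis
        using convex_onD[OF convex_on_abs_powr[OF q], of t "u x - a" "u x - b"] t by simp
    qed
    then have "(\<integral>x. \<bar>u x - ((1 - t) *\<^sub>R a + t *\<^sub>R b)\<bar> powr q \<partial>M)
        \<le> (\<integral>x. (1 - t) * \<bar>u x - a\<bar> powr q + t * \<bar>u x - b\<bar> powr q \<partial>M)"
      by (intro integral_mono Bochner_Integration.integrable_add integrable_mult_right int)
    then show "(\<integral>x. \<bar>u x - ((1 - t) *\<^sub>R a + t *\<^sub>R b)\<bar> powr q \<partial>M)
        \<le> (1 - t) * (\<integral>x. \<bar>u x - a\<bar> powr q \<partial>M) + t * (\<integral>x. \<bar>u x - b\<bar> powr q \<partial>M)"
      by simp
  qed simp
  \<comment> \<open>Lowers the exponent to \<open>1\<close>, the summand \<open>1\<close> covering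
    \<open>|y| <= 1\<close>. It yields both the integrability of \<open>u\<close> and the linear
    growth in \<open>c\<close>.\<close>
  have le: "\<bar>y\<bar> \<le> 1 + \<bar>y\<bar> powr q" for y :: real
  proof (cases "\<bar>y\<bar> \<le> 1")
    case True
    then show ?thesis using powr_ge_zero[of "\<bar>y\<bar>" q] by linarith
  next
    case False
    then show ?thesis using powr_mono[OF q, of "\<bar>y\<bar>"] by simp
  qed
  have int1: "integrable M (\<lambda>x. \<bar>u x\<bar>)"
    by (rule Bochner_Integration.integrable_bound[where f = "\<lambda>x. 1 + \<bar>u x\<bar> powr q"])
       (use u le in \<open>auto intro!: order_trans[OF _ abs_ge_self]\<close>)
  show "V * \<bar>c\<bar> - (V + (\<integral>x. \<bar>u x\<bar> \<partial>M)) \<le> (\<integral>x. \<bar>u x - c\<bar> powr q \<partial>M)" for c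
  proof -
    \<comment> \<open>Triangle inequality \<open>|c| <= |u x| + |u x - c|\<close> combined with
      \<open>le\<close>; integration produces the constants \<open>V\<close> and
      \<open>K\<close>.\<close>
    have "\<bar>c\<bar> - (1 + \<bar>u x\<bar>) \<le> \<bar>u x - c\<bar> powr q" for x
      using le[of "u x - c"] by linarith
    then have "(\<integral>x. \<bar>c\<bar> - (1 + \<bar>u x\<bar>) \<partial>M) \<le> (\<integral>x. \<bar>u x - c\<bar> powr q \<partial>M)"
      using int1 by (intro integral_mono) auto
    then show ?thesis
      using int1 by (simp add: V_def mult.commute)
  qed
qed

text \<open>By strict convexity the midpoint of two distinct minimizers would do strictly better
  than both. The nonzero mass keeps the inequality strict under the integral.\<close>

lemma min_integral_abs_diff_powr_unique:
  fixes u :: "'a \<Rightarrow> real" and q :: real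
  assumes q: "q > 1" and [measurable]: "u \<in> borel_measurable M"
    and u: "integrable M (\<lambda>x. \<bar>u x\<bar> powr q)" and nz: "emeasure M (space M) \<noteq> 0"
    and a: "\<And>c. (\<integral>x. \<bar>u x - a\<bar> powr q \<partial>M) \<le> (\<integral>x. \<bar>u x - c\<bar> powr q \<partial>M)"
    and b: "\<And>c. (\<integral>x. \<bar>u x - b\<bar> powr q \<partial>M) \<le> (\<integral>x. \<bar>u x - c\<bar> powr q \<partial>M)"
  shows "a = b"
proof (rule ccontr)
  assume "a \<noteq> b"
  have int: "integrable M (\<lambda>x. \<bar>u x - c\<bar> powr q)" for c
    using integrable_abs_diff_powr[OF _ assms(2) u] q by simp
  have "\<bar>u x - (a + b) / 2\<bar> powr q < (\<bar>u x - a\<bar> powr q + \<bar>u x - b\<bar> powr q) / 2" for x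
  proof -
    have "u x - (a + b) / 2 = ((u x - a) + (u x - b)) / 2"
      by (simp add: field_simps)
    moreover have "u x - a \<noteq> u x - b" using \<open>a \<noteq> b\<close> by simp
    ultimately show ?thesis
      using abs_powr_midpoint_strict[OF q] by metis
  qed
  then have "(\<integral>x. \<bar>u x - (a + b) / 2\<bar> powr q \<partial>M)
      < (\<integral>x. (\<bar>u x - a\<bar> powr q + \<bar>u x - b\<bar> powr q) / 2 \<partial>M)"
    using int nz by (intro integral_less_AE_space) auto
  also have "\<dots> = ((\<integral>x. \<bar>u x - a\<bar> powr q \<partial>M) + (\<integral>x. \<bar>u x - b\<bar> powr q \<partial>M)) / 2"
    using int by simp
  also have "\<dots> \<le> (\<integral>x. \<bar>u x - (a + b) / 2\<bar> powr q \<partial>M)"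
    using a[of "(a + b) / 2"] b[of "(a + b) / 2"] by simp
  finally show False by simp
qed

lemma integral_abs_diff_powr_submodular:
  fixes u v :: "'a \<Rightarrow> real" and q :: real
  assumes q: "q \<ge> 1" and u: "u \<in> borel_measurable M" "integrable M (\<lambda>x. \<bar>u x\<bar> powr q)"
    and v: "v \<in> borel_measurable M" "integrable M (\<lambda>x. \<bar>v x\<bar> powr q)"
    and le: "AE x in M. u x \<le> v x" and "b \<le> a"
  shows "(\<integral>x. \<bar>u x - b\<bar> powr q \<partial>M) + (\<integral>x. \<bar>v x - a\<bar> powr q \<partial>M)
    \<le> (\<integral>x. \<bar>u x - a\<bar> powr q \<partial>M) + (\<integral>x. \<bar>v x - b\<bar> powr q \<partial>M)"
proof -
  note int = integrable_abs_diff_powr[OF q u] integrable_abs_diff_powr[OF q v]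
  have "(\<integral>x. \<bar>u x - b\<bar> powr q + \<bar>v x - a\<bar> powr q \<partial>M)
      \<le> (\<integral>x. \<bar>u x - a\<bar> powr q + \<bar>v x - b\<bar> powr q \<partial>M)"
    using le int
    by (intro integral_mono_AE)
       (auto elim!: eventually_mono intro!: convex_on_submodular[OF convex_on_abs_powr[OF q]] \<open>b \<le> a\<close>)
  then show ?thesis using int by simp
qed

text \<open>Uniqueness is a hypothesis so that one lemma serves \<open>p = 1\<close>, where it is
  assumed, and \<open>p > 1\<close>, where it is proved. Existence comes from coercivity.\<close>

lemma p_mean_mono_finite_exponent:
  assumes p: "1 \<le> p" "p \<noteq> \<infinity>" and nz: "emeasure M (space M) \<noteq> 0"
    and u: "u \<in> Lp_space M p" and v: "v \<in> Lp_space M p"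
    and uniq: "\<exists>\<^sub>\<le>\<^sub>1 m. is_p_mean M p u m" "\<exists>\<^sub>\<le>\<^sub>1 m. is_p_mean M p v m"
    and le: "AE x in M. u x \<le> v x"
  shows "p_mean M p u \<le> p_mean M p v"
proof (rule p_mean_mono_if)
  have q: "1 \<le> enn2real p"
    using enn2real_mono[of 1 p] p by (auto simp: less_top)
  have ex: "\<exists>m. is_p_mean M p w m" if "w \<in> Lp_space M p" for w
    using exists_min_integral_abs_diff_powr[OF q, of w] that p nz
    by (auto simp: is_p_mean_def Lp_norm_le_iff[OF p] Lp_space_def)
  show "\<exists>!m. is_p_mean M p u m" "\<exists>!m. is_p_mean M p v m"
    using ex u v uniq by (auto simp: Uniq_def)
  fix a b :: real
  assume "b < a"
  \<comment> \<open>If both alternatives failed, adding the two strict inequalities would contradict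
    submodularity.\<close>
  then show "Lp_norm M p (\<lambda>x. u x - b) \<le> Lp_norm M p (\<lambda>x. u x - a) \<or>
      Lp_norm M p (\<lambda>x. v x - a) \<le> Lp_norm M p (\<lambda>x. v x - b)"
    using integral_abs_diff_powr_submodular[OF q _ _ _ _ le, of b a] u v p
    by (auto simp: Lp_norm_le_iff[OF p] Lp_space_def)
qed

lemma is_p_mean_unique:
  assumes p: "1 < p" "p \<noteq> \<infinity>" and nz: "emeasure M (space M) \<noteq> 0" and u: "u \<in> Lp_space M p"
  shows "\<exists>\<^sub>\<le>\<^sub>1 m. is_p_mean M p u m"
proof -
  have q: "1 < enn2real p"
    using p by (cases p) (auto simp: ennreal_less_iff simp flip: ennreal_1)
  show ?thesis
    using min_integral_abs_diff_powr_unique[OF q, of u] u p nz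
    by (auto simp: Uniq_def is_p_mean_def Lp_norm_le_iff Lp_space_def)
qed

end

subsection \<open>The exponent \<open>\<infinity>\<close>\<close>

lemma AE_abs_diff_le_Lp_norm_infinity:
  assumes "u \<in> Lp_space \<nu> \<infinity>"
  shows "AE x in \<nu>. \<bar>u x - c\<bar> \<le> Lp_norm \<nu> \<infinity> (\<lambda>x. u x - c)"
proof -
  let ?N = "\<lambda>c. esssup \<nu> (\<lambda>x. ennreal \<bar>u x - c\<bar>)"
  have [measurable]: "u \<in> borel_measurable \<nu>" and fin: "?N 0 < \<infinity>"
    using assms by (auto simp: Lp_space_def)
  \<comment> \<open>Finiteness of the shifted supremum matters: \<open>enn2real\<close> sends
    infinity to \<open>0\<close>, which would not bound anything.\<close>
  have "?N c \<le> ?N 0 + ennreal \<bar>c\<bar>"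
  proof (rule esssup_I)
    show "AE x in \<nu>. ennreal \<bar>u x - c\<bar> \<le> ?N 0 + ennreal \<bar>c\<bar>"
      using esssup_AE[of "\<lambda>x. ennreal \<bar>u x - 0\<bar>" \<nu>]
    proof eventually_elim
      case (elim x)
      have "ennreal \<bar>u x - c\<bar> \<le> ennreal (\<bar>u x - 0\<bar> + \<bar>c\<bar>)"
        by (intro ennreal_leI) simp
      also have "\<dots> = ennreal \<bar>u x - 0\<bar> + ennreal \<bar>c\<bar>"
        by (intro ennreal_plus) auto
      finally show ?case
        using elim add_right_mono order_trans by blast
    qed
  qed measurable
  also have "\<dots> < \<infinity>" using fin by simp
  finally have *: "?N c < \<infinity>" .
  show ?thesis
    using esssup_AE[of "\<lambda>x. ennreal \<bar>u x - c\<bar>" \<nu>]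
  proof eventually_elim
    case (elim x)
    then show ?case
      using enn2real_mono[OF elim] * by (simp add: Lp_norm_def)
  qed
qed

lemma Lp_norm_infinity_leI:
  assumes [measurable]: "u \<in> borel_measurable \<nu>" and "0 \<le> C" and "AE x in \<nu>. \<bar>u x\<bar> \<le> C"
  shows "Lp_norm \<nu> \<infinity> u \<le> C"
proof -
  have "esssup \<nu> (\<lambda>x. ennreal \<bar>u x\<bar>) \<le> ennreal C"
    using assms by (intro esssup_I) (auto elim!: eventually_mono intro: ennreal_leI)
  then show ?thesis
    using enn2real_leI[OF \<open>0 \<le> C\<close>] by (simp add: Lp_norm_def)
qed

lemma Lp_norm_infinity_nonneg: "0 \<le> Lp_norm \<nu> \<infinity> u"
  by (simp add: Lp_norm_def)

lemma exists_is_p_mean_infinity: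
  assumes nz: "emeasure \<nu> (space \<nu>) \<noteq> 0" and u: "u \<in> Lp_space \<nu> \<infinity>"
  shows "\<exists>m. is_p_mean \<nu> \<infinity> u m"
  unfolding is_p_mean_def
proof (rule convex_coercive_attains_min)
  have [measurable]: "u \<in> borel_measurable \<nu>" using u by (simp add: Lp_space_def)
  let ?N = "\<lambda>c. Lp_norm \<nu> \<infinity> (\<lambda>x. u x - c)"
  note bound = AE_abs_diff_le_Lp_norm_infinity[OF u]
  show "convex_on UNIV ?N"
  proof (rule convex_onI)
    fix t a b :: real
    assume t: "t > 0" "t < 1"
    show "?N ((1 - t) *\<^sub>R a + t *\<^sub>R b) \<le> (1 - t) * ?N a + t * ?N b"
    proof (rule Lp_norm_infinity_leI)
      show "0 \<le> (1 - t) * ?N a + t * ?N b"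
        using t by (intro add_nonneg_nonneg mult_nonneg_nonneg Lp_norm_infinity_nonneg) auto
      show "AE x in \<nu>. \<bar>u x - ((1 - t) *\<^sub>R a + t *\<^sub>R b)\<bar> \<le> (1 - t) * ?N a + t * ?N b"
        using bound[of a] bound[of b]
      proof eventually_elim
        case (elim x)
        have "u x - ((1 - t) *\<^sub>R a + t *\<^sub>R b) = (1 - t) * (u x - a) + t * (u x - b)"
          by (simp add: algebra_simps)
        also have "\<bar>\<dots>\<bar> \<le> (1 - t) * \<bar>u x - a\<bar> + t * \<bar>u x - b\<bar>"
          using t abs_triangle_ineq[of "(1 - t) * (u x - a)" "t * (u x - b)"] by (simp add: abs_mult)
        also have "\<dots> \<le> (1 - t) * ?N a + t * ?N b"
          using t elim by (intro add_mono mult_left_mono) auto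
        finally show ?case .
      qed
    qed measurable
  qed simp
  show "(1::real) > 0" by simp
  show "1 * \<bar>c\<bar> - ?N 0 \<le> ?N c" for c
  proof -
    \<comment> \<open>The statement does not mention \<open>x\<close>, and on a nonzero measure a
      constant statement that holds a.e. is true.\<close>
    have "AE x in \<nu>. 1 * \<bar>c\<bar> - ?N 0 \<le> ?N c"
      using bound[of 0] bound[of c] by eventually_elim linarith
    then show ?thesis
      using nz by (simp add: ae_filter_eq_bot_iff eventually_const_iff)
  qed
qed

text \<open>If \<open>b < a\<close> both attain the minimum \<open>N\<close>, then a.e.
  \<open>u\<close> lies in \<open>[a - N, a + N]\<close> and in \<open>[b - N, b + N]\<close>, hence
  in \<open>[a - N, b + N]\<close>. This interval is centred at \<open>(a + b) / 2\<close> and has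
  radius \<open>N - (a - b) / 2\<close>, smaller than \<open>N\<close>.\<close>

lemma is_p_mean_infinity_unique:
  assumes nz: "emeasure \<nu> (space \<nu>) \<noteq> 0" and u: "u \<in> Lp_space \<nu> \<infinity>"
  shows "\<exists>\<^sub>\<le>\<^sub>1 m. is_p_mean \<nu> \<infinity> u m"
proof -
  let ?N = "\<lambda>c. Lp_norm \<nu> \<infinity> (\<lambda>x. u x - c)"
  have [measurable]: "u \<in> borel_measurable \<nu>" using u by (simp add: Lp_space_def)
  note bound = AE_abs_diff_le_Lp_norm_infinity[OF u]
  have "\<not> b < a" if a: "is_p_mean \<nu> \<infinity> u a" and b: "is_p_mean \<nu> \<infinity> u b" for a b
  proof
    assume "b < a"
    have eq: "?N a = ?N b"
      using a b by (intro antisym) (auto simp: is_p_mean_def)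
    have *: "AE x in \<nu>. \<bar>u x - (a + b) / 2\<bar> \<le> ?N a - (a - b) / 2"
      using bound[of a] bound[of b] unfolding eq by eventually_elim (simp add: field_simps)
    then have "AE x in \<nu>. 0 \<le> ?N a - (a - b) / 2"
      by eventually_elim linarith
    then have "0 \<le> ?N a - (a - b) / 2"
      using nz by (simp add: ae_filter_eq_bot_iff eventually_const_iff)
    then have "?N ((a + b) / 2) \<le> ?N a - (a - b) / 2"
      using * by (intro Lp_norm_infinity_leI) auto
    moreover have "?N a \<le> ?N ((a + b) / 2)"
      using a by (simp add: is_p_mean_def)
    ultimately show False using \<open>b < a\<close> by argo
  qed
  then show ?thesis
    by (meson Uniq_I linorder_neqE)
qed

lemma p_mean_mono_infinity:
  assumes nz: "emeasure \<nu> (space \<nu>) \<noteq> 0"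
    and u: "u \<in> Lp_space \<nu> \<infinity>" and v: "v \<in> Lp_space \<nu> \<infinity>"
    and le: "AE x in \<nu>. u x \<le> v x"
  shows "p_mean \<nu> \<infinity> u \<le> p_mean \<nu> \<infinity> v"
proof (rule p_mean_mono_if)
  show "\<exists>!m. is_p_mean \<nu> \<infinity> u m" "\<exists>!m. is_p_mean \<nu> \<infinity> v m"
    using exists_is_p_mean_infinity[OF nz] is_p_mean_infinity_unique[OF nz] u v
    by (meson Uniq_D)+
  have [measurable]: "u \<in> borel_measurable \<nu>" "v \<in> borel_measurable \<nu>"
    using u v by (auto simp: Lp_space_def)
  fix a b :: real
  assume "b < a"
  define N where "N = Lp_norm \<nu> \<infinity> (\<lambda>x. u x - a)"
  define K where "K = Lp_norm \<nu> \<infinity> (\<lambda>x. v x - b)"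
  have nonneg: "0 \<le> max N K" unfolding N_def using Lp_norm_infinity_nonneg by (rule max.coboundedI1)
  have bounds: "AE x in \<nu>. \<bar>u x - a\<bar> \<le> N \<and> \<bar>v x - b\<bar> \<le> K \<and> u x \<le> v x"
    using AE_abs_diff_le_Lp_norm_infinity[OF u, of a] AE_abs_diff_le_Lp_norm_infinity[OF v, of b] le
    unfolding N_def K_def by eventually_elim auto
  \<comment> \<open>Almost everywhere \<open>-N <= u - a <= u - b <= v - b <= K\<close>. Likewise
    \<open>v - a\<close> lies between \<open>u - a\<close> and \<open>v - b\<close>, which gives the
    second bound.\<close>
  have "Lp_norm \<nu> \<infinity> (\<lambda>x. u x - b) \<le> max N K"
    using nonneg
  proof (intro Lp_norm_infinity_leI)
    show "AE x in \<nu>. \<bar>u x - b\<bar> \<le> max N K"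
      using bounds by eventually_elim (use \<open>b < a\<close> in \<open>auto simp: le_max_iff_disj\<close>)
  qed auto
  moreover have "Lp_norm \<nu> \<infinity> (\<lambda>x. v x - a) \<le> max N K"
    using nonneg
  proof (intro Lp_norm_infinity_leI)
    show "AE x in \<nu>. \<bar>v x - a\<bar> \<le> max N K"
      using bounds by eventually_elim (use \<open>b < a\<close> in \<open>auto simp: le_max_iff_disj\<close>)
  qed auto
  \<comment> \<open>Whichever of \<open>N\<close> and \<open>K\<close> is the larger decides which
    alternative holds.\<close>
  ultimately show "Lp_norm \<nu> \<infinity> (\<lambda>x. u x - b) \<le> N \<or> Lp_norm \<nu> \<infinity> (\<lambda>x. v x - a) \<le> K"
    by (auto simp: max_def split: if_splits)
qed

subsection \<open>Continuous functions on a compact space\<close>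

lemma sets_sigma_openin_space:
  assumes "sets \<nu> = sets (sigma (topspace X) {U. openin X U})"
  shows "space \<nu> = topspace X"
proof -
  have "{U. openin X U} \<subseteq> Pow (topspace X)" by (auto dest: openin_subset)
  then show ?thesis
    using sets_eq_imp_space_eq[OF assms] by (simp add: space_measure_of)
qed

text \<open>Preimages of open sets are open, hence measurable; compactness bounds \<open>w\<close>,
  and bounded measurable functions are integrable for a finite measure. This brings
  \<open>p = 1\<close> under the finite-exponent lemma.\<close>

lemma continuous_map_in_Lp_space_1:
  assumes X: "compact_space X" and sets: "sets \<nu> = sets (sigma (topspace X) {U. openin X U})"
    and fin: "finite_measure \<nu>" and w: "continuous_map X euclideanreal w"
  shows "w \<in> Lp_space \<nu> 1"
proof -
  note space = sets_sigma_openin_space[OF sets]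
  have "{U. openin X U} \<subseteq> Pow (topspace X)" by (auto dest: openin_subset)
  then have open_sets: "U \<in> sets \<nu>" if "openin X U" for U
    using that by (simp add: sets sets_measure_of sigma_sets.Basic)
  have [measurable]: "w \<in> borel_measurable \<nu>"
  proof (rule borel_measurableI)
    fix S :: "real set"
    assume "open S"
    then have "openin X {x \<in> topspace X. w x \<in> S}"
      using w by (intro openin_continuous_map_preimage) auto
    moreover have "{x \<in> topspace X. w x \<in> S} = w -` S \<inter> space \<nu>"
      by (auto simp: space)
    ultimately show "w -` S \<inter> space \<nu> \<in> sets \<nu>"
      using open_sets by simp
  qed
  have "compact (w ` topspace X)"
    using image_compactin[of X "topspace X" euclideanreal w] X w by (simp add: compact_space_def)
  then obtain B where B: "\<And>x. x \<in> topspace X \<Longrightarrow> \<bar>w x\<bar> \<le> B"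
    using compact_imp_bounded[of "w ` topspace X"] unfolding bounded_iff by auto
  have "integrable \<nu> (\<lambda>x. \<bar>w x\<bar>)"
    using B by (intro finite_measure.integrable_const_bound[OF fin, where B = B]) (auto simp: space)
  then show ?thesis
    by (simp add: Lp_space_def)
qed

theorem theorem2p5:
  fixes X :: "'a topology" and \<nu> :: "'a measure" and p :: ennreal and u v :: "'a \<Rightarrow> real"
  assumes "compact_space X"
    and "radon_measure X \<nu>"
    and "emeasure \<nu> (topspace X) \<noteq> 0"
    and "emeasure \<nu> (topspace X) < \<infinity>"
    and "p = 1 \<Longrightarrow> \<forall>w. continuous_map X euclideanreal w \<longrightarrow> (\<exists>\<^sub>\<le>\<^sub>1 m. is_p_mean \<nu> 1 w m)"
    and "(1 < p \<and> u \<in> Lp_space \<nu> p \<and> v \<in> Lp_space \<nu> p) \<or>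
         (p = 1 \<and> continuous_map X euclideanreal u \<and> continuous_map X euclideanreal v)"
    and "AE x in \<nu>. u x \<le> v x"
  shows "p_mean \<nu> p u \<le> p_mean \<nu> p v"
proof -
  have sets: "sets \<nu> = sets (sigma (topspace X) {U. openin X U})"
    using assms(2) by (simp add: radon_measure_def)
  note space = sets_sigma_openin_space[OF sets]
  have nz: "emeasure \<nu> (space \<nu>) \<noteq> 0" using assms(3) by (simp add: space)
  have fin: "finite_measure \<nu>"
    using assms(4) by (intro finite_measureI) (auto simp: space)
  \<comment> \<open>The cases differ in the source of uniqueness: overlapping intervals, strict
    convexity, and the assumption on continuous functions.\<close>
  consider "p = \<infinity>" | "1 < p" "p \<noteq> \<infinity>" | "p = 1" using assms(6) by blast
  then show ?thesis
  proof cases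
    case 1
    then show ?thesis
      using assms(6,7) p_mean_mono_infinity[OF nz] by auto
  next
    case 2
    then have "u \<in> Lp_space \<nu> p" "v \<in> Lp_space \<nu> p" using assms(6) by auto
    then show ?thesis
      using finite_measure.p_mean_mono_finite_exponent[OF fin _ _ nz] 2
        finite_measure.is_p_mean_unique[OF fin _ _ nz] assms(7) by simp
  next
    case 3
    then have "continuous_map X euclideanreal u" "continuous_map X euclideanreal v"
      using assms(6) by auto
    then show ?thesis
      using finite_measure.p_mean_mono_finite_exponent[OF fin _ _ nz] 3 assms(5,7)
        continuous_map_in_Lp_space_1[OF assms(1) sets fin] by simp
  qed
qed

end
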